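(* For all $x\in B^c$ and $y\in V$, $$\theta(x)\,p(y\,|\,x)=\bar\theta(x)\,\bar p(y\,|\,x)+\widetilde\theta(x)\,\widetilde p(y\,|\,x),$$ or equivalently $J(x\to y)=\bar J(x\to y)+\widetilde J(x\to y)$, where $J$, $\bar J$, $\widetilde J$ are the probability fluxes of the first passage paths, the nonreactive trajectories and the reactive trajectories, respectively.
   Context: $V=\{1,\dots,n\}$ with $n>1$; $p(y\,|\,x)$, $x,y\in V$, is the probability that a discrete-time Markov chain $(x_k)_{k\ge0}$ on $V$ jumps from $x$ to $y$ (so $\sum_{y}p(y\,|\,x)=1$). $A,B\subset V$ are disjoint and nonempty, complements are taken in $V$, and $\mu$ is a probability distribution on $A$. For $x\in V$, a set $A$ (resp. $B$) is reachable from $x$ if there is a finite path $x_0=x,x_1,\dots,x_k$, $k\ge0$, with $x_k\in A$ (resp. $x_k\in B$), $x_l\in(A\cup B)^c$ for $1\le l\le k-1$, and $p(x_{l+1}\,|\,x_l)>0$ for $0\le l\le k-1$. Standing assumption: $(A\cup B)^c\ne\emptyset$; from each $x\in(A\cup B)^c$ either $A$ or $B$ is reachable; and $B$ is reachable from each $x\in A$. $\tau_A=\min\{k\ge0:x_k\in A\}$, $\tau_B=\min\{k\ge 0:x_k\in B\}$ ($+\infty$ if never reached), with subscript $x$ when $x_0=x$. Committor: $q(x)=\mathbb P(\tau_{B,x}<\tau_{A,x})$, $x\in V$. For $x_0\in A$, the last hitting time of $A$ is $\sigma=\max\{l: x_l\in A,\ 0\le l<\tau_B\}$. $\langle\cdot\rangle$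 denotes expectation over first passage paths $(x_0,\dots,x_{\tau_B})$ of the chain with $x_0\sim\mu$. $V^-=\{x\in V:q(x)<1\}$, $V^+=\{x\in B^c:\sum_{z\in V}p(z\,|\,x)q(z)>0\}$. $\theta(x)=\langle\sum_{l=0}^{\tau_B}\mathbf 1_x(x_l)\rangle$, $\bar\theta(x)=\langle\sum_{l=0}^{\sigma}\mathbf 1_x(x_l)\rangle$, $\widetilde\theta(x)=\langle\sum_{l=\sigma}^{\tau_B}\mathbf 1_x(x_l)\rangle$. $\bar p(y\,|\,x)=\frac{p(y\,|\,x)(1-q(y))}{1-q(x)}$ for $x,y\in V^-$. For $x\in V^+$, $y\in V^+\cup B$: $\widetilde p(y\,|\,x)=\frac{p(y\,|\,x)q(y)}{q(x)}$ if $x\notin A$, and $\widetilde p(y\,|\,x)=\frac{p(y\,|\,x)q(y)}{\sum_{z\in V}p(z\,|\,x)q(z)}$ if $x\in A$. Fluxes: $J(x\to y)=\theta(x)p(y\,|\,x)$; $\bar J(x\to y)=\bar\theta(x)\bar p(y\,|\,x)$ for $x,y\in V^-$ and $0$ otherwise; $\widetilde J(x\to y)=\widetilde\theta(x)\widetilde p(y\,|\,x)$ for $x\in V^+$, $y\in V^+\cup B$ and $0$ otherwise. In the displayed identity, the products $\bar\theta(x)\bar p(y\,|\,x)$ and $\widetilde\theta(x)\widetilde p(y\,|\,x)$ are read as $0$ for pairs $(x,y)$ where $\bar p$, respectively $\widetilde p$, is not defined. *)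

theory Defs
  imports "HOL-Probability.Probability" "HOL-Library.Extended_Nat"
begin

text \<open>
  A transition function on the states is given as \<open>p :: nat \<Rightarrow> nat pmf\<close>, where \<open>pmf (p x) y\<close>
  is the probability of a jump from \<open>x\<close> to \<open>y\<close>. The chain with transition function \<open>p\<close> and
  initial distribution \<open>\<nu>\<close> is realised as the coordinate process on \<open>nat \<Rightarrow> nat\<close>, under the
  measure obtained from the Ionescu-Tulcea theorem.
\<close>

definition step_kernel :: "(nat \<Rightarrow> nat pmf) \<Rightarrow> nat pmf \<Rightarrow> nat \<Rightarrow> (nat \<Rightarrow> nat) \<Rightarrow> nat measure" where
  "step_kernel p \<nu> k \<omega> = (case k of 0 \<Rightarrow> measure_pmf \<nu> | Suc j \<Rightarrow> measure_pmf (p (\<omega> j)))"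

lemma step_kernel_simps [simp]:
  "step_kernel p \<nu> 0 \<omega> = measure_pmf \<nu>"
  "step_kernel p \<nu> (Suc j) \<omega> = measure_pmf (p (\<omega> j))"
  by (simp_all add: step_kernel_def)

lemma Ionescu_Tulcea_step_kernel: "Ionescu_Tulcea (step_kernel p \<nu>) (\<lambda>_. count_space UNIV)"
proof (rule Ionescu_Tulcea.intro)
  show "step_kernel p \<nu> k \<in> PiM {0..<k} (\<lambda>_. count_space UNIV) \<rightarrow>\<^sub>M subprob_algebra (count_space UNIV)"
    for k
  proof (cases k)
    case 0
    then show ?thesis
      by (simp add: step_kernel_def [abs_def] measurable_const measure_pmf_in_subprob_algebra)
  next
    case (Suc j)
    have "(\<lambda>\<omega>. measure_pmf (p (\<omega> j))) \<in>
        PiM {0..<k} (\<lambda>_. count_space UNIV) \<rightarrow>\<^sub>M subprob_algebra (count_space UNIV)"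
      by (rule measurable_compose [where N = "count_space UNIV" and f = "\<lambda>\<omega>. \<omega> j"])
         (auto simp: Suc measure_pmf_in_subprob_algebra intro!: measurable_component_singleton)
    then show ?thesis
      by (simp add: Suc step_kernel_def [abs_def])
  qed
  show "prob_space (step_kernel p \<nu> k \<omega>)"
    if "\<omega> \<in> space (PiM {0..<k} (\<lambda>_. count_space UNIV))" for k \<omega>
    by (cases k) (simp_all add: prob_space_measure_pmf)
qed

interpretation chain: Ionescu_Tulcea "step_kernel p \<nu>" "\<lambda>_. count_space UNIV" for p \<nu>
  by (rule Ionescu_Tulcea_step_kernel)

definition path_law :: "(nat \<Rightarrow> nat pmf) \<Rightarrow> nat pmf \<Rightarrow> (nat \<Rightarrow> nat) measure" where
  "path_law p \<nu> = chain.PF.lim p \<nu>"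

lemma sets_path_law: "sets (path_law p \<nu>) = sets (PiM UNIV (\<lambda>_. count_space UNIV))"
  by (simp add: path_law_def chain.PF.sets_lim)

lemma space_path_law [simp]: "space (path_law p \<nu>) = UNIV"
  by (simp add: path_law_def chain.PF.space_lim space_PiM)

lemma prefix_in_sets:
  "finite J \<Longrightarrow> PiE J (\<lambda>i. {f i}) \<in> sets (PiM J (\<lambda>_. count_space (UNIV :: nat set)))"
  by (rule sets_PiM_I_finite) auto

lemma emeasure_chain_C:
  "emeasure (chain.C p \<nu> 0 (Suc k) (\<lambda>_. undefined)) (PiE {0..<Suc k} (\<lambda>i. {f i})) =
     ennreal (pmf \<nu> (f 0) * (\<Prod>i<k. pmf (p (f i)) (f (Suc i))))"
proof (induction k)
  case 0
  have X: "PiE {0..<Suc 0} (\<lambda>i. {f i}) \<in> sets (PiM {0..<Suc 0} (\<lambda>_. count_space UNIV))"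
    by (rule prefix_in_sets) simp
  have v: "(\<lambda>x. (\<lambda>_. undefined)(0 := x)) -` PiE {0..<Suc 0} (\<lambda>i. {f i}) = {f 0}"
    by (simp add: set_eq_iff PiE_iff extensional_def)
  have "chain.C p \<nu> 0 (Suc 0) (\<lambda>_. undefined) = chain.eP p \<nu> 0 (\<lambda>_. undefined)"
    using bind_return [OF chain.measurable_eP [of p \<nu> 0], of "\<lambda>_. undefined"]
    by (simp add: space_PiM)
  then show ?case
    using chain.emeasure_eP [OF _ X, of "\<lambda>_. undefined" p \<nu>] v
    by (simp add: space_PiM emeasure_pmf_single del: chain.C.simps)
next
  case (Suc k)
  let ?X = "\<lambda>k. PiE {0..<Suc k} (\<lambda>i. {f i})"
  let ?M = "\<lambda>k. PiM {0..<k} (\<lambda>_. count_space (UNIV :: nat set))"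
  let ?C = "chain.C p \<nu> 0 (Suc k) (\<lambda>_. undefined)"
  have X: "?X k \<in> sets (?M (Suc k))" for k
    by (rule prefix_in_sets) simp
  have u: "(\<lambda>_. undefined) \<in> space (?M 0)"
    by (simp add: space_PiM PiE_iff extensional_def)
  have sp: "space ?C = space (?M (Suc k))" and st: "sets ?C = sets (?M (Suc k))"
    using chain.space_C [OF u, of p \<nu> "Suc k"] chain.sets_C [OF u, of p \<nu> "Suc k"]
    by (simp_all del: chain.C.simps)
  have eP: "chain.eP p \<nu> (Suc k) \<in> ?C \<rightarrow>\<^sub>M subprob_algebra (?M (Suc (Suc k)))"
    using chain.measurable_eP [of p \<nu> "Suc k"] by (simp only: measurable_cong_sets [OF st refl])
  have "emeasure (chain.C p \<nu> 0 (Suc (Suc k)) (\<lambda>_. undefined)) (?X (Suc k)) =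
      (\<integral>\<^sup>+\<omega>. emeasure (chain.eP p \<nu> (Suc k) \<omega>) (?X (Suc k)) \<partial>?C)"
    unfolding chain.C.simps(2) [of _ _ _ "Suc k"] add_0
    by (rule emeasure_bind [OF _ eP X]) (simp add: sp space_PiM PiE_eq_empty_iff del: chain.C.simps)
  also have "\<dots> = (\<integral>\<^sup>+\<omega>. ennreal (pmf (p (f k)) (f (Suc k))) * indicator (?X k) \<omega> \<partial>?C)"
  proof (rule nn_integral_cong)
    fix \<omega> assume "\<omega> \<in> space ?C"
    then have \<omega>: "\<omega> \<in> space (?M (Suc k))" by (simp only: sp)
    have "fun_upd \<omega> (Suc k) -` ?X (Suc k) = (if \<omega> \<in> ?X k then {f (Suc k)} else {})"
      using \<omega> by (auto simp: PiE_iff extensional_def space_PiM atLeastLessThanSuc split: if_splits)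
    moreover have "\<omega> \<in> ?X k \<Longrightarrow> \<omega> k = f k"
      by (auto simp: PiE_iff)
    ultimately show "emeasure (chain.eP p \<nu> (Suc k) \<omega>) (?X (Suc k)) =
        ennreal (pmf (p (f k)) (f (Suc k))) * indicator (?X k) \<omega>"
      using chain.emeasure_eP [OF \<omega> X, of p \<nu>] by (auto simp: emeasure_pmf_single)
  qed
  also have "\<dots> = ennreal (pmf (p (f k)) (f (Suc k))) * emeasure ?C (?X k)"
    using X [of k] by (intro nn_integral_cmult_indicator) (simp only: st)
  finally show ?case
    by (simp add: Suc.IH ennreal_mult [symmetric] prod_nonneg mult_ac del: chain.C.simps)
qed

lemma measure_path_law_cylinder:
  "measure (path_law p \<nu>) {\<omega>. \<forall>i\<le>k. \<omega> i = f i} =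
     pmf \<nu> (f 0) * (\<Prod>i<k. pmf (p (f i)) (f (Suc i)))"
proof -
  let ?J = "{0..<Suc k}" and ?X = "PiE {0..<Suc k} (\<lambda>i. {f i})"
  have "{\<omega>. \<forall>i\<le>k. \<omega> i = f i} = prod_emb UNIV (\<lambda>_. count_space UNIV) ?J ?X"
    by (auto simp: prod_emb_def restrict_def PiE_iff extensional_def)
  then have "emeasure (path_law p \<nu>) {\<omega>. \<forall>i\<le>k. \<omega> i = f i} = emeasure (chain.CI p \<nu> ?J) ?X"
    using chain.lim [of ?J ?X p \<nu>] prefix_in_sets [of ?J f] by (simp add: path_law_def)
  also have "\<dots> = emeasure (chain.C p \<nu> 0 (Suc k) (\<lambda>_. undefined)) ?X"
    using chain.emeasure_CI [of ?J "Suc k" ?X p \<nu>] prefix_in_sets [of ?J f]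
    by (simp add: prod_emb_id PiE_mono del: chain.C.simps)
  finally show ?thesis
    unfolding emeasure_chain_C by (simp add: measure_def prod_nonneg)
qed

definition reachable ::
    "nat set \<Rightarrow> (nat \<Rightarrow> nat pmf) \<Rightarrow> nat set \<Rightarrow> nat set \<Rightarrow> nat set \<Rightarrow> nat \<Rightarrow> bool" where
  "reachable V p A B S x \<longleftrightarrow>
     (\<exists>k w. w 0 = x \<and> w k \<in> S \<and>
        (\<forall>l. 1 \<le> l \<and> l < k \<longrightarrow> w l \<in> V - (A \<union> B)) \<and>
        (\<forall>l<k. pmf (p (w l)) (w (Suc l)) > 0))"

text \<open>\<open>Inf {} = \<infinity>\<close> for type \<^typ>\<open>enat\<close>.\<close>

definition hit_time :: "nat set \<Rightarrow> (nat \<Rightarrow> nat) \<Rightarrow> enat" where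
  "hit_time S \<omega> = Inf (enat ` {k. \<omega> k \<in> S})"

definition committor :: "(nat \<Rightarrow> nat pmf) \<Rightarrow> nat set \<Rightarrow> nat set \<Rightarrow> nat \<Rightarrow> real" where
  "committor p A B x =
     measure (path_law p (return_pmf x)) {\<omega>. hit_time B \<omega> < hit_time A \<omega>}"

text \<open>
  The set below is finite and nonempty whenever \<open>\<omega> 0 \<in> A\<close>, \<open>A\<close> and \<open>B\<close> are disjoint and
  \<open>hit_time B \<omega> < \<infinity>\<close>. Paths with \<open>hit_time B \<omega> = \<infinity>\<close> form a null set under the reachability
  assumptions, so their values of \<open>Max\<close> here, and of the sums over infinite sets in \<open>visits\<close>
  and \<open>visits_rea\<close>, play no role.
\<close>

definition last_exit :: "nat set \<Rightarrow> nat set \<Rightarrow> (nat \<Rightarrow> nat) \<Rightarrow> nat" where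
  "last_exit A B \<omega> = Max {l. \<omega> l \<in> A \<and> enat l < hit_time B \<omega>}"

definition visits :: "(nat \<Rightarrow> nat pmf) \<Rightarrow> nat pmf \<Rightarrow> nat set \<Rightarrow> nat \<Rightarrow> real" where
  "visits p \<mu> B x =
     (\<integral>\<omega>. (\<Sum>l\<in>{l. enat l \<le> hit_time B \<omega>}. indicator {x} (\<omega> l)) \<partial>path_law p \<mu>)"

definition visits_nonrea ::
    "(nat \<Rightarrow> nat pmf) \<Rightarrow> nat pmf \<Rightarrow> nat set \<Rightarrow> nat set \<Rightarrow> nat \<Rightarrow> real" where
  "visits_nonrea p \<mu> A B x =
     (\<integral>\<omega>. (\<Sum>l\<le>last_exit A B \<omega>. indicator {x} (\<omega> l)) \<partial>path_law p \<mu>)"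

definition visits_rea ::
    "(nat \<Rightarrow> nat pmf) \<Rightarrow> nat pmf \<Rightarrow> nat set \<Rightarrow> nat set \<Rightarrow> nat \<Rightarrow> real" where
  "visits_rea p \<mu> A B x =
     (\<integral>\<omega>. (\<Sum>l\<in>{l. last_exit A B \<omega> \<le> l \<and> enat l \<le> hit_time B \<omega>}. indicator {x} (\<omega> l))
        \<partial>path_law p \<mu>)"

definition V_minus ::
    "nat set \<Rightarrow> (nat \<Rightarrow> nat pmf) \<Rightarrow> nat set \<Rightarrow> nat set \<Rightarrow> nat set" where
  "V_minus V p A B = {x \<in> V. committor p A B x < 1}"

definition V_plus ::
    "nat set \<Rightarrow> (nat \<Rightarrow> nat pmf) \<Rightarrow> nat set \<Rightarrow> nat set \<Rightarrow> nat set" where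
  "V_plus V p A B = {x \<in> V - B. (\<Sum>z\<in>V. pmf (p x) z * committor p A B z) > 0}"

text \<open>Both transition probabilities are extended by \<open>0\<close> to pairs where they are not defined.\<close>

definition p_nonrea ::
    "nat set \<Rightarrow> (nat \<Rightarrow> nat pmf) \<Rightarrow> nat set \<Rightarrow> nat set \<Rightarrow> nat \<Rightarrow> nat \<Rightarrow> real" where
  "p_nonrea V p A B x y =
     (if x \<in> V_minus V p A B \<and> y \<in> V_minus V p A B
      then pmf (p x) y * (1 - committor p A B y) / (1 - committor p A B x)
      else 0)"

definition p_rea ::
    "nat set \<Rightarrow> (nat \<Rightarrow> nat pmf) \<Rightarrow> nat set \<Rightarrow> nat set \<Rightarrow> nat \<Rightarrow> nat \<Rightarrow> real" where
  "p_rea V p A B x y =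
     (if x \<in> V_plus V p A B \<and> y \<in> V_plus V p A B \<union> B
      then if x \<in> A
        then pmf (p x) y * committor p A B y / (\<Sum>z\<in>V. pmf (p x) z * committor p A B z)
        else pmf (p x) y * committor p A B y / committor p A B x
      else 0)"

definition flux :: "(nat \<Rightarrow> nat pmf) \<Rightarrow> nat pmf \<Rightarrow> nat set \<Rightarrow> nat \<Rightarrow> nat \<Rightarrow> real" where
  "flux p \<mu> B x y = visits p \<mu> B x * pmf (p x) y"

definition flux_nonrea ::
    "nat set \<Rightarrow> (nat \<Rightarrow> nat pmf) \<Rightarrow> nat pmf \<Rightarrow> nat set \<Rightarrow> nat set \<Rightarrow> nat \<Rightarrow> nat \<Rightarrow> real" where
  "flux_nonrea V p \<mu> A B x y =
     (if x \<in> V_minus V p A B \<and> y \<in> V_minus V p A B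
      then visits_nonrea p \<mu> A B x * p_nonrea V p A B x y else 0)"

definition flux_rea ::
    "nat set \<Rightarrow> (nat \<Rightarrow> nat pmf) \<Rightarrow> nat pmf \<Rightarrow> nat set \<Rightarrow> nat set \<Rightarrow> nat \<Rightarrow> nat \<Rightarrow> real" where
  "flux_rea V p \<mu> A B x y =
     (if x \<in> V_plus V p A B \<and> y \<in> V_plus V p A B \<union> B
      then visits_rea p \<mu> A B x * p_rea V p A B x y else 0)"

end

theory Submission
  imports Defs
begin

text \<open>
  Fix \<open>x \<notin> B\<close>. A visit to \<open>x\<close> at time \<open>l\<close> before hitting \<open>B\<close> counts as nonreactive iff the path
  restarted at \<open>l\<close> hits \<open>A\<close> before \<open>B\<close>, and as reactive iff the restarted path does not return to
  \<open>A\<close> at a positive time before hitting \<open>B\<close>. By the Markov property these restarted events have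
  probabilities \<open>1 - q x\<close> and \<open>r x = (\<Sum>z. p x z * q z)\<close>, independently of the past; the first one
  uses that \<open>B\<close> is hit almost surely. Hence the two visit counts are \<open>\<theta> x * (1 - q x)\<close> and
  \<open>\<theta> x * r x\<close>, and the two fluxes are \<open>\<theta> x * p x y * (1 - q y)\<close> and \<open>\<theta> x * p x y * q y\<close>. Since all
  expectations are computed in \<open>[0, \<infinity>]\<close> and \<open>enn2real\<close> is multiplicative, finiteness of
  \<open>\<theta>\<close> plays no role.
\<close>

section \<open>The Markov property of the path measure\<close>

abbreviation path_space :: "(nat \<Rightarrow> nat) measure" where
  "path_space \<equiv> PiM UNIV (\<lambda>_. count_space UNIV)"

lemma sets_path_law_cong [measurable_cong]: "sets (path_law p \<nu>) = sets path_space"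
  by (rule sets_path_law)

text \<open>The total mass is read off at the empty index set: the cylinder over \<open>{}\<close>
  is the whole space, and the marginal there is a probability measure.\<close>

lemma prob_space_path_law: "prob_space (path_law p \<nu>)"
proof
  interpret init: prob_space "chain.CI p \<nu> {}"
    by (rule chain.PF.prob_space_P) auto
  let ?X = "space (chain.CI p \<nu> {})"
  have "?X = space (PiM {} (\<lambda>_. count_space UNIV))"
    by (rule chain.PF.space_P) auto
  moreover from this have "emeasure (path_law p \<nu>) (prod_emb UNIV (\<lambda>_. count_space UNIV) {} ?X) =
      emeasure (chain.CI p \<nu> {}) ?X"
    unfolding path_law_def by (intro chain.lim) auto
  ultimately show "emeasure (path_law p \<nu>) (space (path_law p \<nu>)) = 1"
    using init.emeasure_space_1 by (simp add: prod_emb_def space_PiM restrict_def)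
qed

interpretation path: prob_space "path_law p \<nu>" for p \<nu>
  by (rule prob_space_path_law)

lemma measurable_coordinate [measurable]: "(\<lambda>\<omega>. \<omega> i) \<in> path_space \<rightarrow>\<^sub>M count_space (UNIV :: nat set)"
  by (rule measurable_component_singleton) simp

lemma measurable_shift: "(\<lambda>\<omega> i. \<omega> (i + l)) \<in> path_space \<rightarrow>\<^sub>M path_space"
  by (rule measurable_abs_UNIV) (rule measurable_coordinate)

lemma space_path_space: "space path_space = UNIV"
  by (simp add: space_PiM)

lemma Collect_in_sets_path_law:
  assumes "Measurable.pred path_space P"
  shows "{\<omega>. P \<omega>} \<in> sets (path_law p \<nu>)"
proof -
  have "{\<omega> \<in> space path_space. P \<omega>} \<in> sets path_space"
    using assms by (rule predE)
  then show ?thesis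
    unfolding sets_path_law space_path_space by simp
qed

text \<open>The empty set is included because two cylinders with conflicting prefixes do not meet;
  with it the family is stable under intersection.\<close>

definition cylinders :: "(nat \<Rightarrow> nat) set set" where
  "cylinders = insert {} (range (\<lambda>(k, f). {\<omega>. \<forall>i\<le>k. \<omega> i = f i}))"

lemma cylinder_in_sets: "{\<omega>. \<forall>i\<le>k. \<omega> i = f i} \<in> sets (path_law p \<nu>)"
  by (rule Collect_in_sets_path_law) measurable

lemma shift_in_sets:
  assumes "S \<in> sets path_space"
  shows "{\<omega>. (\<lambda>i. \<omega> (i + l)) \<in> S} \<in> sets path_space"
  using measurable_sets [OF measurable_shift [of l] assms]
  by (simp add: space_path_space vimage_def)

lemma Int_stable_cylinders: "Int_stable cylinders"
proof (rule Int_stableI)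
  have *: "{\<omega>. \<forall>i\<le>k. \<omega> i = f i} \<inter> {\<omega>. \<forall>i\<le>l. \<omega> i = g i} \<in> cylinders"
    if "k \<le> l" for k l and f g :: "nat \<Rightarrow> nat"
  proof (cases "\<forall>i\<le>k. f i = g i")
    case True
    then have "{\<omega>. \<forall>i\<le>k. \<omega> i = f i} \<inter> {\<omega>. \<forall>i\<le>l. \<omega> i = g i} = {\<omega>. \<forall>i\<le>l. \<omega> i = g i}"
      using that by auto
    then show ?thesis by (auto simp: cylinders_def)
  next
    case False
    then have "{\<omega>. \<forall>i\<le>k. \<omega> i = f i} \<inter> {\<omega>. \<forall>i\<le>l. \<omega> i = g i} = {}"
      using that by force
    then show ?thesis by (auto simp: cylinders_def)
  qed
  fix a b assume "a \<in> cylinders" "b \<in> cylinders"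
  then consider "a = {} \<or> b = {}"
    | k f l g where "a = {\<omega>. \<forall>i\<le>k. \<omega> i = f i}" "b = {\<omega>. \<forall>i\<le>l. \<omega> i = g i}"
    by (auto simp: cylinders_def)
  then show "a \<inter> b \<in> cylinders"
  proof cases
    case 1
    then show ?thesis by (auto simp: cylinders_def)
  next
    case 2
    then show ?thesis
      using * [of k l f g] * [of l k g f] by (cases "k \<le> l") (auto simp: Int_commute)
  qed
qed

text \<open>An event about one coordinate fixes only finitely many values once the prefix is known,
  and there are countably many prefixes, so it is a countable union of cylinders.\<close>

lemma sets_path_space_eq_sigma_cylinders: "sets path_space = sigma_sets UNIV cylinders"
proof
  show "sigma_sets UNIV cylinders \<subseteq> sets path_space"
  proof -
    have "cylinders \<subseteq> sets path_space"
      using cylinder_in_sets by (auto simp: cylinders_def sets_path_law)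
    then show ?thesis
      by (rule sets.sigma_sets_subset [of cylinders path_space, unfolded space_path_space])
  qed
  have "{\<omega>. \<omega> i \<in> X} \<in> sigma_sets UNIV cylinders" for i and X :: "nat set"
  proof -
    interpret sigma_algebra UNIV "sigma_sets UNIV cylinders"
      by (rule sigma_algebra_sigma_sets) simp
    \<comment> \<open>Lists index the prefixes because they form a countable type, unlike functions
      on \<open>nat\<close>. Lists that are too short do no harm: \<open>xs ! i \<in> X\<close>
      still forces \<open>\<omega> i \<in> X\<close>.\<close>
    have "{\<omega>. \<omega> i \<in> X} = (\<Union>xs\<in>{xs. xs ! i \<in> X}. {\<omega>. \<forall>j\<le>i. \<omega> j = xs ! j})"
    proof -
      have "\<exists>xs. xs ! i \<in> X \<and> (\<forall>j\<le>i. \<omega> j = xs ! j)" if "\<omega> i \<in> X" for \<omega> :: "nat \<Rightarrow> nat"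
        using that by (intro exI [of _ "map \<omega> [0..<Suc i]"]) (auto simp del: upt_Suc)
      then show ?thesis by auto
    qed
    also have "\<dots> \<in> sigma_sets UNIV cylinders"
      by (rule countable_UN'') (auto simp: cylinders_def intro!: sigma_sets.Basic)
    finally show ?thesis .
  qed
  then show "sets path_space \<subseteq> sigma_sets UNIV cylinders"
    unfolding sets_PiM_single space_count_space PiE_UNIV_domain Pi_UNIV
    by (intro sigma_sets_mono) auto
qed

lemma prod_lessThan_add:
  fixes g :: "nat \<Rightarrow> 'a::comm_monoid_mult"
  shows "(\<Prod>i<l + m. g i) = (\<Prod>i<l. g i) * (\<Prod>i<m. g (l + i))"
  by (induction m) (simp_all add: mult.assoc)

text \<open>Both sides are explicit products of jump probabilities. If \<open>g 0 = f l\<close>, the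
  two prefixes glue to one of length \<open>l + m\<close> and the product splits at
  \<open>l\<close>; otherwise the left event is empty and \<open>return_pmf (f l)\<close> gives
  \<open>g 0\<close> mass 0.\<close>

lemma markov_cylinder_cylinder:
  "measure (path_law p \<nu>)
      ({\<omega>. \<forall>i\<le>l. \<omega> i = f i} \<inter> {\<omega>. (\<lambda>i. \<omega> (i + l)) \<in> {\<omega>. \<forall>i\<le>m. \<omega> i = g i}}) =
   measure (path_law p \<nu>) {\<omega>. \<forall>i\<le>l. \<omega> i = f i} *
   measure (path_law p (return_pmf (f l))) {\<omega>. \<forall>i\<le>m. \<omega> i = g i}" (is "measure _ ?E = _")
proof (cases "g 0 = f l")
  case True
  let ?h = "\<lambda>i. if i \<le> l then f i else g (i - l)"
  \<comment> \<open>The two pieces overlap at time \<open>l\<close>, where \<open>f l = g 0\<close>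
    makes them agree.\<close>
  have h: "?h (l + i) = g i" for i
    using True by auto
  have "?E = {\<omega>. \<forall>i\<le>l + m. \<omega> i = ?h i}"
  proof (intro equalityI subsetI)
    fix \<omega> :: "nat \<Rightarrow> nat" assume \<omega>: "\<omega> \<in> ?E"
    have "\<omega> i = ?h i" if "i \<le> l + m" for i
    proof (cases "i \<le> l")
      case False
      then have "i - l \<le> m" "i - l + l = i" using that by auto
      moreover have "\<forall>j\<le>m. \<omega> (j + l) = g j" using \<omega> by simp
      ultimately show ?thesis using False by metis
    qed (use \<omega> in auto)
    then show "\<omega> \<in> {\<omega>. \<forall>i\<le>l + m. \<omega> i = ?h i}" by blast
  next
    fix \<omega> :: "nat \<Rightarrow> nat" assume \<omega>: "\<omega> \<in> {\<omega>. \<forall>i\<le>l + m. \<omega> i = ?h i}"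
    have "\<omega> (i + l) = g i" if "i \<le> m" for i
    proof -
      have "\<omega> (l + i) = ?h (l + i)" using \<omega> that by simp
      then show ?thesis unfolding h by (simp add: add.commute)
    qed
    moreover have "\<omega> i = f i" if "i \<le> l" for i
      using \<omega> that by auto
    ultimately show "\<omega> \<in> ?E" by simp
  qed
  moreover have "(\<Prod>i<l + m. pmf (p (?h i)) (?h (Suc i))) =
      (\<Prod>i<l. pmf (p (f i)) (f (Suc i))) * (\<Prod>i<m. pmf (p (g i)) (g (Suc i)))"
    unfolding prod_lessThan_add h add_Suc_right [symmetric] by simp
  ultimately show ?thesis
    using True by (simp only: measure_path_law_cylinder) simp
next
  case False
  then have "?E = {}" by force
  then show ?thesis
    using False by (simp add: measure_path_law_cylinder)
qed

text \<open>As functions of \<open>S\<close>, both sides are finite measures that agree on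
  cylinders, an intersection-stable generator; hence they agree everywhere. The left one is the
  unnormalised law of the shifted path restricted to the prefix.\<close>

lemma markov_cylinder:
  assumes S: "S \<in> sets path_space"
  shows "emeasure (path_law p \<nu>) ({\<omega>. \<forall>i\<le>l. \<omega> i = f i} \<inter> {\<omega>. (\<lambda>i. \<omega> (i + l)) \<in> S}) =
    emeasure (path_law p \<nu>) {\<omega>. \<forall>i\<le>l. \<omega> i = f i} * emeasure (path_law p (return_pmf (f l))) S"
proof -
  let ?P = "path_law p \<nu>" and ?C = "{\<omega>. \<forall>i\<le>l. \<omega> i = f i}"
  let ?M = "distr (density ?P (indicator ?C)) path_space (\<lambda>\<omega> i. \<omega> (i + l))"
  let ?N = "scale_measure (emeasure ?P ?C) (path_law p (return_pmf (f l)))"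
  have M: "emeasure ?M X = emeasure ?P (?C \<inter> {\<omega>. (\<lambda>i. \<omega> (i + l)) \<in> X})"
    if "X \<in> sets path_space" for X
  proof -
    have "(\<lambda>\<omega> i. \<omega> (i + l)) \<in> density ?P (indicator ?C) \<rightarrow>\<^sub>M path_space"
      using measurable_shift by (simp add: measurable_cong_sets [OF sets_path_law refl])
    then show ?thesis
      using that cylinder_in_sets [of l f p \<nu>] shift_in_sets [OF that, of l]
      by (simp add: emeasure_distr emeasure_restricted vimage_def sets_path_law)
  qed
  have "?M = ?N"
  \<comment> \<open>The sets that fix only the starting state \<open>j\<close> form the required
    countable cover by generators of finite measure.\<close>
  proof (rule measure_eqI_generator_eq [OF Int_stable_cylinders, where \<Omega> = UNIV
        and A = "\<lambda>j. {\<omega>. \<forall>i\<le>0. \<omega> i = j}"])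
    fix X assume X: "X \<in> cylinders"
    then consider "X = {}" | m g where "X = {\<omega>. \<forall>i\<le>m. \<omega> i = g i}"
      by (auto simp: cylinders_def)
    then show "emeasure ?M X = emeasure ?N X"
    proof cases
      case 2
      have "X \<in> sets path_space"
        using cylinder_in_sets [of m g p \<nu>] by (simp add: 2 sets_path_law)
      then show ?thesis
        using markov_cylinder_cylinder [of p \<nu> l f m g]
        by (simp add: M) (simp add: 2 path.emeasure_eq_measure flip: ennreal_mult)
    qed simp
  next
    show "emeasure ?M {\<omega>. \<forall>i\<le>0. \<omega> i = j} \<noteq> \<infinity>" for j
      using cylinder_in_sets [of 0 "\<lambda>_. j" p \<nu>]
      by (subst M) (auto simp: sets_path_law path.emeasure_eq_measure)
  qed (auto simp: cylinders_def sets_path_law sets_path_space_eq_sigma_cylinders)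
  then show ?thesis
    using M [OF S] by simp
qed

text \<open>The event about the past is an arbitrary predicate \<open>Q\<close> of the list of the
  first \<open>l + 1\<close> states, so it is a countable disjoint union of cylinders. All of them
  end in \<open>x\<close>, so \<open>markov_cylinder\<close> yields the same second factor for
  each.\<close>

lemma markov:
  assumes S: "S \<in> sets path_space"
  shows "emeasure (path_law p \<nu>)
      {\<omega>. \<omega> l = x \<and> Q (map \<omega> [0..<Suc l]) \<and> (\<lambda>i. \<omega> (i + l)) \<in> S} =
    emeasure (path_law p \<nu>) {\<omega>. \<omega> l = x \<and> Q (map \<omega> [0..<Suc l])} *
    emeasure (path_law p (return_pmf x)) S" (is "emeasure ?P _ = _ * ?e")
proof -
  \<comment> \<open>Fixing the length makes the lists correspond one to one to prefixes, so distinct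
    lists give disjoint cylinders.\<close>
  define I where "I = {xs. length xs = Suc l \<and> xs ! l = x \<and> Q xs}"
  let ?C = "\<lambda>xs. {\<omega>. \<forall>i\<le>l. \<omega> i = xs ! i}"
  let ?S = "{\<omega>. (\<lambda>i. \<omega> (i + l)) \<in> S}"
  have prefix: "(\<omega> \<in> ?C xs) = (map \<omega> [0..<Suc l] = xs)" if "xs \<in> I" for xs and \<omega> :: "nat \<Rightarrow> nat"
  proof -
    have len: "length xs = Suc l" using that by (simp add: I_def)
    then have "(map \<omega> [0..<Suc l] = xs) = (\<forall>i<Suc l. map \<omega> [0..<Suc l] ! i = xs ! i)"
      by (simp only: list_eq_iff_nth_eq) simp
    also have "\<dots> = (\<forall>i<Suc l. \<omega> i = xs ! i)"
      by (simp del: upt_Suc)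
    finally show ?thesis
      by (simp only: mem_Collect_eq less_Suc_eq_le)
  qed
  have Un: "(\<Union>xs\<in>I. ?C xs) = {\<omega>. \<omega> l = x \<and> Q (map \<omega> [0..<Suc l])}"
  proof -
    have "(\<omega> \<in> (\<Union>xs\<in>I. ?C xs)) = (map \<omega> [0..<Suc l] \<in> I)" for \<omega>
      using prefix [of _ \<omega>] by blast
    moreover have "(map \<omega> [0..<Suc l] \<in> I) = (\<omega> l = x \<and> Q (map \<omega> [0..<Suc l]))" for \<omega>
      by (auto simp: I_def simp del: upt_Suc)
    ultimately show ?thesis by blast
  qed
  have disj: "disjoint_family_on ?C I"
    unfolding disjoint_family_on_def
  proof (intro ballI impI)
    fix xs ys assume "xs \<in> I" "ys \<in> I" "xs \<noteq> ys"
    then show "?C xs \<inter> ?C ys = {}"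
      by (simp only: disjoint_iff prefix) simp
  qed
  have S': "?S \<in> sets ?P"
    using shift_in_sets [OF S] by (simp only: sets_path_law)
  have "{\<omega>. \<omega> l = x \<and> Q (map \<omega> [0..<Suc l]) \<and> (\<lambda>i. \<omega> (i + l)) \<in> S} = (\<Union>xs\<in>I. ?C xs) \<inter> ?S"
    unfolding Un by blast
  also have "\<dots> = (\<Union>xs\<in>I. ?C xs \<inter> ?S)"
    by blast
  finally have "emeasure ?P {\<omega>. \<omega> l = x \<and> Q (map \<omega> [0..<Suc l]) \<and> (\<lambda>i. \<omega> (i + l)) \<in> S} =
      emeasure ?P (\<Union>xs\<in>I. ?C xs \<inter> ?S)"
    by (rule arg_cong)
  also have "\<dots> = (\<integral>\<^sup>+xs. emeasure ?P (?C xs \<inter> ?S) \<partial>count_space I)"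
  proof (rule emeasure_UN_countable)
    show "disjoint_family_on (\<lambda>xs. ?C xs \<inter> ?S) I"
      using disj unfolding disjoint_family_on_def by blast
    show "?C xs \<inter> ?S \<in> sets ?P" for xs
      using cylinder_in_sets S' by (rule sets.Int)
  qed simp
  also have "\<dots> = (\<integral>\<^sup>+xs. emeasure ?P (?C xs) * ?e \<partial>count_space I)"
  proof (rule nn_integral_cong)
    fix xs assume "xs \<in> space (count_space I)"
    then have "xs ! l = x" by (simp add: I_def)
    then show "emeasure ?P (?C xs \<inter> ?S) = emeasure ?P (?C xs) * ?e"
      using markov_cylinder [OF S, of p \<nu> l "(!) xs"] by (simp only:)
  qed
  also have "\<dots> = (\<integral>\<^sup>+xs. emeasure ?P (?C xs) \<partial>count_space I) * ?e"
    by (rule nn_integral_multc) simp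
  also have "(\<integral>\<^sup>+xs. emeasure ?P (?C xs) \<partial>count_space I) = emeasure ?P (\<Union>xs\<in>I. ?C xs)"
    using disj by (intro emeasure_UN_countable [symmetric] cylinder_in_sets) simp_all
  finally show ?thesis
    by (simp only: Un)
qed

section \<open>Almost sure statements and one-step analysis\<close>

lemma AE_coordinate:
  assumes "\<And>x. x \<notin> X \<Longrightarrow> measure (path_law p \<nu>) {\<omega>. \<omega> l = x} = 0"
  shows "AE \<omega> in path_law p \<nu>. \<omega> l \<in> X"
proof -
  have "AE \<omega> in path_law p \<nu>. \<omega> l = x \<longrightarrow> x \<in> X" for x
  proof (cases "x \<in> X")
    case False
    then have "AE \<omega> in path_law p \<nu>. \<omega> \<notin> {\<omega>. \<omega> l = x}"
      using assms [of x]
      by (intro AE_not_in null_setsI)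
         (auto simp: path.emeasure_eq_measure intro!: Collect_in_sets_path_law)
    then show ?thesis by eventually_elim simp
  qed simp
  then have "AE \<omega> in path_law p \<nu>. \<forall>x. \<omega> l = x \<longrightarrow> x \<in> X"
    by (rule AE_all_countable [THEN iffD2, rule_format])
  then show ?thesis by eventually_elim simp
qed

lemma AE_start: "AE \<omega> in path_law p \<nu>. \<omega> 0 \<in> set_pmf \<nu>"
proof (rule AE_coordinate)
  fix x assume "x \<notin> set_pmf \<nu>"
  then show "measure (path_law p \<nu>) {\<omega>. \<omega> 0 = x} = 0"
    using measure_path_law_cylinder [of p \<nu> 0 "\<lambda>_. x"] by (simp add: set_pmf_eq)
qed

lemma AE_start_point: "AE \<omega> in path_law p (return_pmf x). \<omega> 0 = x"
  using AE_start [of "return_pmf x" p] by simp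

text \<open>Almost every path of the chain started in \<open>x\<close> has
  \<open>\<omega> 0 = x\<close>. This lets events be rewritten using the known starting state before
  the first step is taken.\<close>

lemma measure_cong_start:
  assumes "\<And>\<omega>. \<omega> 0 = x \<Longrightarrow> P \<omega> = Q \<omega>"
    and "Measurable.pred path_space P" "Measurable.pred path_space Q"
  shows "measure (path_law p (return_pmf x)) {\<omega>. P \<omega>} = measure (path_law p (return_pmf x)) {\<omega>. Q \<omega>}"
  using AE_start_point [of x p] assms
  by (intro path.finite_measure_eq_AE Collect_in_sets_path_law) (auto elim!: eventually_mono)

lemma path_law_step: "measure (path_law p (return_pmf x)) {\<omega>. \<omega> 1 = z} = pmf (p x) z"
proof -
  have "measure (path_law p (return_pmf x)) {\<omega>. \<omega> 1 = z} =
      measure (path_law p (return_pmf x)) {\<omega>. \<forall>i\<le>1. \<omega> i = (if i = 0 then x else z)}"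
    by (rule measure_cong_start) (auto simp: le_Suc_eq)
  then show ?thesis
    by (simp add: measure_path_law_cylinder)
qed

text \<open>Split by the state at time 1 and apply \<open>markov\<close> there. This is the source
  of all harmonic equations below.\<close>

lemma markov_first_step:
  assumes S: "S \<in> sets path_space" and "finite V" and V: "set_pmf (p x) \<subseteq> V"
  shows "measure (path_law p (return_pmf x)) {\<omega>. (\<lambda>i. \<omega> (i + 1)) \<in> S} =
    (\<Sum>z\<in>V. pmf (p x) z * measure (path_law p (return_pmf z)) S)"
proof -
  let ?P = "path_law p (return_pmf x)"
  let ?E = "\<lambda>z. {\<omega>. \<omega> 1 = z \<and> (\<lambda>i. \<omega> (i + 1)) \<in> S}"
  have E: "?E z \<in> sets ?P" for z
  proof -
    have "?E z = {\<omega>. \<omega> 1 = z} \<inter> {\<omega>. (\<lambda>i. \<omega> (i + 1)) \<in> S}" by blast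
    moreover have "{\<omega>. \<omega> 1 = z} \<in> sets ?P"
      by (rule Collect_in_sets_path_law) measurable
    ultimately show ?thesis
      using shift_in_sets [OF S, of 1] by (simp only: sets_path_law sets.Int)
  qed
  have "AE \<omega> in ?P. \<omega> 1 \<in> V"
    using V by (intro AE_coordinate) (auto simp: path_law_step set_pmf_eq simp del: One_nat_def)
  then have "measure ?P {\<omega>. (\<lambda>i. \<omega> (i + 1)) \<in> S} = measure ?P (\<Union>z\<in>V. ?E z)"
  proof (intro path.finite_measure_eq_AE)
    show "{\<omega>. (\<lambda>i. \<omega> (i + 1)) \<in> S} \<in> sets ?P"
      using shift_in_sets [OF S] by (simp only: sets_path_law)
  qed (use E \<open>finite V\<close> in \<open>auto elim!: eventually_mono intro!: sets.finite_UN\<close>)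
  also have "\<dots> = (\<Sum>z\<in>V. measure ?P (?E z))"
    using E \<open>finite V\<close>
    by (intro path.finite_measure_finite_Union) (auto simp: disjoint_family_on_def)
  also have "\<dots> = (\<Sum>z\<in>V. pmf (p x) z * measure (path_law p (return_pmf z)) S)"
  proof (rule sum.cong [OF refl])
    fix z
    have "ennreal (measure ?P (?E z)) =
        ennreal (measure ?P {\<omega>. \<omega> 1 = z} * measure (path_law p (return_pmf z)) S)"
      using markov [OF S, of p "return_pmf x" 1 z "\<lambda>_. True"]
      by (simp add: path.emeasure_eq_measure ennreal_mult del: One_nat_def)
    then show "measure ?P (?E z) = pmf (p x) z * measure (path_law p (return_pmf z)) S"
      unfolding path_law_step by (subst (asm) ennreal_inj) auto
  qed
  finally show ?thesis .
qed

section \<open>Hitting times\<close>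

text \<open>Turns comparisons of possibly infinite times into bounded quantifiers, which makes
  measurability and shifting of paths straightforward.\<close>

lemma less_hit_time_iff: "enat l < hit_time S \<omega> \<longleftrightarrow> (\<forall>i\<le>l. \<omega> i \<notin> S)"
proof -
  have "hit_time S \<omega> \<le> enat l \<longleftrightarrow> (\<exists>i\<le>l. \<omega> i \<in> S)"
  proof
    assume le: "hit_time S \<omega> \<le> enat l"
    then have "enat ` {k. \<omega> k \<in> S} \<noteq> {}"
      unfolding hit_time_def by (metis Inf_empty enat_ord_code(5) enat_ord_simps(5) top_enat_def)
    \<comment> \<open>A nonempty set of \<open>enat\<close> attains its infimum, which is defined by
      \<open>LEAST\<close>.\<close>
    then have "hit_time S \<omega> \<in> enat ` {k. \<omega> k \<in> S}"
      unfolding hit_time_def Inf_enat_def by (auto intro: LeastI)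
    then show "\<exists>i\<le>l. \<omega> i \<in> S" using le by auto
  next
    assume "\<exists>i\<le>l. \<omega> i \<in> S"
    then obtain i where "i \<le> l" "\<omega> i \<in> S" by blast
    then show "hit_time S \<omega> \<le> enat l"
      unfolding hit_time_def by (intro Inf_lower2 [of "enat i"]) auto
  qed
  then show ?thesis by (metis not_le)
qed

lemma le_hit_time_iff: "enat l \<le> hit_time S \<omega> \<longleftrightarrow> (\<forall>i<l. \<omega> i \<notin> S)"
  unfolding hit_time_def le_Inf_iff by (auto simp: not_le [symmetric])

text \<open>The witness \<open>m\<close> may be any visit to \<open>S\<close> before
  \<open>T\<close> is met, so no first hitting time is mentioned.\<close>

definition hits_first :: "nat set \<Rightarrow> nat set \<Rightarrow> (nat \<Rightarrow> nat) set" where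
  "hits_first S T = {\<omega>. \<exists>m. \<omega> m \<in> S \<and> (\<forall>i\<le>m. \<omega> i \<notin> T)}"

lemma pred_hits_first [measurable]: "Measurable.pred path_space (\<lambda>\<omega>. \<omega> \<in> hits_first S T)"
  unfolding hits_first_def mem_Collect_eq by measurable

lemma hits_first_in_sets: "hits_first S T \<in> sets path_space"
  using Collect_in_sets_path_law [OF pred_hits_first [of S T]] by (simp add: sets_path_law)

lemma hit_time_less_iff: "hit_time S \<omega> < hit_time T \<omega> \<longleftrightarrow> \<omega> \<in> hits_first S T"
proof
  assume less: "hit_time S \<omega> < hit_time T \<omega>"
  then obtain m where m: "hit_time S \<omega> = enat m"
    by (cases "hit_time S \<omega>") auto
  then have "\<not> enat m < hit_time S \<omega>" by simp
  then obtain i where "i \<le> m" "\<omega> i \<in> S"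
    by (auto simp: less_hit_time_iff)
  moreover have "\<forall>i\<le>m. \<omega> i \<notin> T"
    using less by (simp add: m less_hit_time_iff)
  ultimately show "\<omega> \<in> hits_first S T"
    by (auto simp: hits_first_def)
next
  assume "\<omega> \<in> hits_first S T"
  then obtain m where "\<omega> m \<in> S" "\<forall>i\<le>m. \<omega> i \<notin> T"
    by (auto simp: hits_first_def)
  then have "hit_time S \<omega> \<le> enat m" "enat m < hit_time T \<omega>"
    using less_hit_time_iff [of m S \<omega>] by (auto simp: less_hit_time_iff not_less [symmetric])
  then show "hit_time S \<omega> < hit_time T \<omega>" by (rule le_less_trans)
qed

lemma committor_eq: "committor p A B x = measure (path_law p (return_pmf x)) (hits_first B A)"
  by (simp add: committor_def hit_time_less_iff)

text \<open>Look at the first visit to \<open>B\<close>: either \<open>A\<close> was met up to then,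
  and by disjointness strictly earlier, or it was not. The visit to \<open>B\<close> excludes paths
  on which neither event happens.\<close>

lemma hits_first_swap:
  assumes "A \<inter> B = {}" and B: "\<omega> k \<in> B"
  shows "\<omega> \<in> hits_first A B \<longleftrightarrow> \<omega> \<notin> hits_first B A"
proof
  show "\<omega> \<in> hits_first A B \<Longrightarrow> \<omega> \<notin> hits_first B A"
    unfolding hits_first_def using nat_le_linear by blast
  define m where "m = (LEAST m. \<omega> m \<in> B)"
  have m: "\<omega> m \<in> B" "\<And>i. i < m \<Longrightarrow> \<omega> i \<notin> B"
    unfolding m_def using B by (auto intro: LeastI dest: not_less_Least)
  assume "\<omega> \<notin> hits_first B A"
  then obtain i where i: "i \<le> m" "\<omega> i \<in> A"
    using m(1) by (auto simp: hits_first_def)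
  then have "i \<noteq> m"
    using m(1) assms(1) by auto
  then show "\<omega> \<in> hits_first A B"
    using i m(2) by (auto simp: hits_first_def)
qed

lemma hits_first_shift:
  assumes "\<omega> 0 \<notin> S" "\<omega> 0 \<notin> T"
  shows "\<omega> \<in> hits_first S T \<longleftrightarrow> (\<lambda>i. \<omega> (i + 1)) \<in> hits_first S T"
proof
  assume "\<omega> \<in> hits_first S T"
  then obtain m where m: "\<omega> m \<in> S" "\<forall>i\<le>m. \<omega> i \<notin> T"
    by (auto simp: hits_first_def)
  then obtain k where "m = Suc k"
    using assms(1) by (cases m) auto
  then show "(\<lambda>i. \<omega> (i + 1)) \<in> hits_first S T"
    using m by (auto simp: hits_first_def)
next
  assume "(\<lambda>i. \<omega> (i + 1)) \<in> hits_first S T"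
  then obtain m where m: "\<omega> (Suc m) \<in> S" "\<forall>i\<le>m. \<omega> (Suc i) \<notin> T"
    by (auto simp: hits_first_def)
  then have "\<forall>i\<le>Suc m. \<omega> i \<notin> T"
    using assms(2) by (metis Suc_le_mono not0_implies_Suc)
  then show "\<omega> \<in> hits_first S T"
    using m(1) by (auto simp: hits_first_def)
qed

text \<open>Time 0 is exempt because a start in \<open>A\<close> is the last exit itself when no
  later visit to \<open>A\<close> precedes \<open>B\<close>.\<close>

definition never_returns :: "nat set \<Rightarrow> nat set \<Rightarrow> (nat \<Rightarrow> nat) set" where
  "never_returns A B = {\<omega>. \<forall>m. \<omega> m \<in> A \<and> (\<forall>i\<le>m. \<omega> i \<notin> B) \<longrightarrow> m = 0}"

lemma pred_never_returns [measurable]: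
  "Measurable.pred path_space (\<lambda>\<omega>. \<omega> \<in> never_returns A B)"
  unfolding never_returns_def mem_Collect_eq by measurable

lemma never_returns_in_sets: "never_returns A B \<in> sets path_space"
  using Collect_in_sets_path_law [OF pred_never_returns [of A B]] by (simp add: sets_path_law)

text \<open>A return at a positive time is a visit of the path shifted by one step at any time.
  Hence the probability becomes a sum over the first jump, also when the start lies in
  \<open>A\<close>.\<close>

lemma never_returns_iff:
  assumes "\<omega> 0 \<notin> B"
  shows "\<omega> \<in> never_returns A B \<longleftrightarrow> (\<lambda>i. \<omega> (i + 1)) \<notin> hits_first A B"
proof -
  have "(\<forall>i\<le>Suc m. \<omega> i \<notin> B) \<longleftrightarrow> (\<forall>i\<le>m. \<omega> (Suc i) \<notin> B)" for m
    using assms by (metis Suc_le_mono not0_implies_Suc)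
  moreover have "\<omega> \<in> never_returns A B \<longleftrightarrow>
      (\<forall>m. \<not> (\<omega> (Suc m) \<in> A \<and> (\<forall>i\<le>Suc m. \<omega> i \<notin> B)))"
    unfolding never_returns_def using not0_implies_Suc by blast
  ultimately show ?thesis
    by (simp add: hits_first_def)
qed

section \<open>Finite chains that can reach B from everywhere\<close>

text \<open>In \<open>reach\<close> the path to \<open>B\<close> may pass through \<open>A\<close>.
  This merges the reachability assumptions for the different kinds of states into one.\<close>

locale finite_chain =
  fixes V A B :: "nat set" and p :: "nat \<Rightarrow> nat pmf"
  assumes finite_V: "finite V"
    and closed: "\<And>x. x \<in> V \<Longrightarrow> set_pmf (p x) \<subseteq> V"
    and A_subset: "A \<subseteq> V" and B_subset: "B \<subseteq> V" and disjoint: "A \<inter> B = {}"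
    and reach: "\<And>x. x \<in> V \<Longrightarrow> \<exists>b\<in>B. (x, b) \<in> {(x, y). pmf (p x) y > 0}\<^sup>*"
begin

abbreviation "law x \<equiv> path_law p (return_pmf x)"

abbreviation "q \<equiv> committor p A B"

lemma sum_pmf: "x \<in> V \<Longrightarrow> (\<Sum>z\<in>V. pmf (p x) z) = 1"
  using finite_V closed by (rule sum_pmf_eq_1)

abbreviation "avoids \<equiv> {\<omega>. \<forall>i. \<omega> i \<notin> B}"

lemma avoids_in_sets: "avoids \<in> sets path_space"
  using Collect_in_sets_path_law [of "\<lambda>\<omega>. \<forall>i. \<omega> i \<notin> B"]
  unfolding sets_path_law by measurable

text \<open>The probability of avoiding \<open>B\<close> is harmonic outside \<open>B\<close>, so by the maximum principle
  its maximum propagates along possible jumps until it reaches \<open>B\<close>, where it is \<open>0\<close>.\<close>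

lemma measure_avoids:
  assumes "x \<in> V"
  shows "measure (law x) avoids = 0"
proof -
  define h where "h z = measure (law z) avoids" for z
  have B: "h z = 0" if "z \<in> B" for z
  proof -
    have "h z = measure (law z) {\<omega>. False}"
      unfolding h_def
    proof (rule measure_cong_start)
      show "(\<forall>i. \<omega> i \<notin> B) = False" if "\<omega> 0 = z" for \<omega> :: "nat \<Rightarrow> nat"
        using that \<open>z \<in> B\<close> by metis
    qed measurable
    then show ?thesis by simp
  qed
  have harmonic: "h z = (\<Sum>y\<in>V. pmf (p z) y * h y)" if "z \<in> V" "z \<notin> B" for z
  proof -
    have "h z = measure (law z) {\<omega>. \<forall>i. \<omega> (i + 1) \<notin> B}"
      unfolding h_def
    proof (rule measure_cong_start)
      show "(\<forall>i. \<omega> i \<notin> B) = (\<forall>i. \<omega> (i + 1) \<notin> B)" if "\<omega> 0 = z" for \<omega> :: "nat \<Rightarrow> nat"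
        using that \<open>z \<notin> B\<close> by (metis Suc_eq_plus1 not0_implies_Suc)
    qed measurable
    then show ?thesis
      using markov_first_step [where x = z, OF avoids_in_sets finite_V closed] that by (simp add: h_def)
  qed
  define M where "M = Max (h ` V)"
  have le: "h z \<le> M" if "z \<in> V" for z
    using that finite_V by (simp add: M_def)
  obtain w where w: "w \<in> V" "h w = M"
  proof -
    have "M \<in> h ` V"
      unfolding M_def using finite_V assms by (intro Max_in) auto
    then show ?thesis using that by blast
  qed
  have "M \<le> 0"
  proof (rule ccontr)
    assume "\<not> M \<le> 0"
    then have notB: "z \<notin> B" if "h z = M" for z
      using B [of z] that by auto
    \<comment> \<open>The maximum propagates along every possible jump from
      \<open>w\<close>.\<close>
    have "z \<in> V \<and> h z = M" if "(w, z) \<in> {(x, y). pmf (p x) y > 0}\<^sup>*" for z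
      using that
    proof induction
      case base
      then show ?case using w by simp
    next
      case (step y z)
      then have y: "y \<in> V" "h y = M" and yz: "pmf (p y) z > 0" by auto
      then have z: "z \<in> V" using closed [of y] by (auto simp: set_pmf_iff)
      \<comment> \<open>By harmonicity at \<open>y\<close>, the nonnegative deficits
        \<open>M - h v\<close> average to 0, so the deficit vanishes at each \<open>v\<close> with a
        positive jump probability.\<close>
      have "(\<Sum>v\<in>V. pmf (p y) v * (M - h v)) =
          M * (\<Sum>v\<in>V. pmf (p y) v) - (\<Sum>v\<in>V. pmf (p y) v * h v)"
        by (simp add: algebra_simps sum_subtractf sum_distrib_left)
      also have "\<dots> = 0"
        using y notB [of y] harmonic [of y] by (simp add: sum_pmf)
      finally have "pmf (p y) z * (M - h z) = 0"
        using sum_nonneg_eq_0_iff [OF finite_V, of "\<lambda>v. pmf (p y) v * (M - h v)"] le z by simp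
      then show ?case using yz z by simp
    qed
    moreover obtain b where "b \<in> B" "(w, b) \<in> {(x, y). pmf (p x) y > 0}\<^sup>*"
      using reach w by blast
    ultimately show False using notB by blast
  qed
  then show ?thesis
    using le [OF assms] by (intro antisym) (simp_all add: h_def)
qed

text \<open>The Markov property at time 0 transfers \<open>measure_avoids\<close> from fixed
  starting states to \<open>\<nu>\<close>, one of finitely many starts at a time.\<close>

lemma AE_hits_B:
  assumes \<nu>: "set_pmf \<nu> \<subseteq> V"
  shows "AE \<omega> in path_law p \<nu>. \<exists>i. \<omega> i \<in> B"
proof -
  have "AE \<omega> in path_law p \<nu>. \<omega> 0 = x \<longrightarrow> \<omega> \<notin> avoids" if "x \<in> V" for x
  proof -
    have "emeasure (path_law p \<nu>) {\<omega>. \<omega> 0 = x \<and> \<omega> \<in> avoids} = 0"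
      using markov [OF avoids_in_sets, of p \<nu> 0 x "\<lambda>_. True"] measure_avoids [OF that]
      by (simp add: path.emeasure_eq_measure)
    then have "AE \<omega> in path_law p \<nu>. \<omega> \<notin> {\<omega>. \<omega> 0 = x \<and> \<omega> \<in> avoids}"
      by (intro AE_not_in null_setsI Collect_in_sets_path_law) auto
    then show ?thesis by eventually_elim simp
  qed
  then have "AE \<omega> in path_law p \<nu>. \<forall>x\<in>V. \<omega> 0 = x \<longrightarrow> \<omega> \<notin> avoids"
    by (intro AE_ball_countable' countable_finite [OF finite_V])
  with AE_start [of \<nu> p] show ?thesis
    by eventually_elim (use \<nu> in auto)
qed

text \<open>By \<open>hits_first_swap\<close> the two hitting events are complementary up to the
  null set of paths that never meet \<open>B\<close>.\<close>

lemma measure_hits_first_A: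
  assumes "x \<in> V"
  shows "measure (law x) (hits_first A B) = 1 - q x"
proof -
  have "AE \<omega> in law x. \<exists>i. \<omega> i \<in> B"
    using assms by (intro AE_hits_B) simp
  moreover have "space (law x) - hits_first B A \<in> sets (law x)"
    using hits_first_in_sets by (intro sets.compl_sets) (simp add: sets_path_law)
  ultimately have "measure (law x) (hits_first A B) = measure (law x) (space (law x) - hits_first B A)"
    using hits_first_in_sets
    by (intro path.finite_measure_eq_AE)
       (auto simp: sets_path_law hits_first_swap [OF disjoint] elim!: eventually_mono)
  also have "\<dots> = 1 - q x"
    unfolding committor_eq using hits_first_in_sets
    by (intro path.prob_compl) (simp add: sets_path_law)
  finally show ?thesis .
qed

lemma committor_A: "x \<in> A \<Longrightarrow> q x = 0"
proof -
  assume "x \<in> A"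
  have "measure (law x) {\<omega>. \<omega> \<in> hits_first B A} = measure (law x) {\<omega>. False}"
  proof (rule measure_cong_start)
    show "(\<omega> \<in> hits_first B A) = False" if "\<omega> 0 = x" for \<omega>
      using that \<open>x \<in> A\<close> by (auto simp: hits_first_def)
  qed measurable
  then show ?thesis by (simp add: committor_eq)
qed

lemma committor_step:
  assumes "x \<in> V - (A \<union> B)"
  shows "q x = (\<Sum>z\<in>V. pmf (p x) z * q z)"
proof -
  have "measure (law x) {\<omega>. \<omega> \<in> hits_first B A} =
      measure (law x) {\<omega>. (\<lambda>i. \<omega> (i + 1)) \<in> hits_first B A}"
  proof (rule measure_cong_start)
    show "(\<omega> \<in> hits_first B A) = ((\<lambda>i. \<omega> (i + 1)) \<in> hits_first B A)" if "\<omega> 0 = x" for \<omega>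
      using that assms by (intro hits_first_shift) auto
    show "Measurable.pred path_space (\<lambda>\<omega>. (\<lambda>i. \<omega> (i + 1)) \<in> hits_first B A)"
      by (rule measurable_compose [OF measurable_shift pred_hits_first])
  qed measurable
  then show ?thesis
    using markov_first_step [where x = x, OF hits_first_in_sets finite_V closed] assms
    by (simp add: committor_eq)
qed

text \<open>After one step the event is the complement of \<open>hits_first A B\<close>, which has
  probability \<open>1 - (1 - q z)\<close> from \<open>z\<close>.\<close>

lemma measure_never_returns:
  assumes "x \<in> V - B"
  shows "measure (law x) (never_returns A B) = (\<Sum>z\<in>V. pmf (p x) z * q z)"
proof -
  let ?S = "space path_space - hits_first A B"
  have S: "?S \<in> sets path_space"
    using hits_first_in_sets by (rule sets.compl_sets)
  have "measure (law x) {\<omega>. \<omega> \<in> never_returns A B} = measure (law x) {\<omega>. (\<lambda>i. \<omega> (i + 1)) \<in> ?S}"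
  proof (rule measure_cong_start)
    show "(\<omega> \<in> never_returns A B) = ((\<lambda>i. \<omega> (i + 1)) \<in> ?S)" if "\<omega> 0 = x" for \<omega>
      using that assms by (subst never_returns_iff) (auto simp: space_path_space)
    show "Measurable.pred path_space (\<lambda>\<omega>. (\<lambda>i. \<omega> (i + 1)) \<in> ?S)"
      using shift_in_sets [OF S, of 1] by (simp add: pred_def space_path_space)
  qed measurable
  also have "\<dots> = (\<Sum>z\<in>V. pmf (p x) z * measure (law z) ?S)"
    using assms by (intro markov_first_step [OF S finite_V] closed) simp
  also have "\<dots> = (\<Sum>z\<in>V. pmf (p x) z * q z)"
  proof (rule sum.cong [OF refl])
    fix z assume "z \<in> V"
    moreover have "measure (law z) ?S = 1 - measure (law z) (hits_first A B)"
      using path.prob_compl [of "hits_first A B" p "return_pmf z"] hits_first_in_sets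
      by (simp add: sets_path_law space_path_space)
    ultimately show "pmf (p x) z * measure (law z) ?S = pmf (p x) z * q z"
      by (simp add: measure_hits_first_A)
  qed
  finally show ?thesis by simp
qed

section \<open>Expected numbers of visits\<close>

text \<open>Common core of the three visit counts. The last assumption describes membership in the
  random index set, at visits to \<open>x\<close>, by the past (no \<open>B\<close> up to
  \<open>l\<close>) and the future (\<open>S\<close>). Expectation and sum over times are exchanged,
  and \<open>markov\<close> yields a factor independent of \<open>l\<close>.\<close>

lemma integral_visits:
  fixes L :: "(nat \<Rightarrow> nat) \<Rightarrow> nat set"
  assumes S: "S \<in> sets path_space"
    and L [measurable]: "\<And>l. Measurable.pred path_space (\<lambda>\<omega>. l \<in> L \<omega>)"
    and AE: "AE \<omega> in path_law p \<nu>. finite (L \<omega>) \<and> (\<forall>l. \<omega> l = x \<longrightarrow>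
      (l \<in> L \<omega> \<longleftrightarrow> (\<forall>i\<le>l. \<omega> i \<notin> B) \<and> (\<lambda>i. \<omega> (i + l)) \<in> S))"
  shows "(\<integral>\<omega>. (\<Sum>l\<in>L \<omega>. indicator {x} (\<omega> l)) \<partial>path_law p \<nu>) =
    enn2real (\<Sum>l. emeasure (path_law p \<nu>) {\<omega>. \<omega> l = x \<and> (\<forall>i\<le>l. \<omega> i \<notin> B)}) * measure (law x) S"
proof -
  let ?P = "path_law p \<nu>"
  let ?f = "\<lambda>\<omega>. \<Sum>l\<in>L \<omega>. indicator {x} (\<omega> l) :: real"
  let ?E = "\<lambda>l. {\<omega>. \<omega> l = x \<and> (\<forall>i\<le>l. \<omega> i \<notin> B) \<and> (\<lambda>i. \<omega> (i + l)) \<in> S}"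
  have E: "?E l \<in> sets ?P" for l
  proof -
    have "?E l = {\<omega>. \<omega> l = x \<and> (\<forall>i\<le>l. \<omega> i \<notin> B)} \<inter> {\<omega>. (\<lambda>i. \<omega> (i + l)) \<in> S}"
      by blast
    moreover have "{\<omega>. \<omega> l = x \<and> (\<forall>i\<le>l. \<omega> i \<notin> B)} \<in> sets ?P"
      by (rule Collect_in_sets_path_law) measurable
    ultimately show ?thesis
      using shift_in_sets [OF S, of l] by (simp only: sets_path_law sets.Int)
  qed
  \<comment> \<open>A sum over an infinite set is 0 by convention; the cardinality form makes
    measurability evident.\<close>
  have f_eq: "?f \<omega> = (if finite (L \<omega>) then real (card {l. l \<in> L \<omega> \<and> \<omega> l = x}) else 0)" for \<omega>
  proof (cases "finite (L \<omega>)")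
    case True
    then have "?f \<omega> = (\<Sum>l\<in>{l. l \<in> L \<omega> \<and> \<omega> l = x}. 1)"
      by (intro sum.mono_neutral_cong_right) auto
    then show ?thesis using True by simp
  qed simp
  have f: "?f \<in> borel_measurable ?P"
    unfolding f_eq by measurable
  \<comment> \<open>If the expectation is infinite, both sides are 0: the left one as the integral
    of a non-integrable function, the right one because
    \<open>enn2real \<infinity> = 0\<close>.\<close>
  have "(\<integral>\<omega>. ?f \<omega> \<partial>?P) = enn2real (\<integral>\<^sup>+\<omega>. ennreal (?f \<omega>) \<partial>?P)"
    using f by (intro integral_eq_nn_integral) (auto intro!: sum_nonneg)
  also have "(\<integral>\<^sup>+\<omega>. ennreal (?f \<omega>) \<partial>?P) = (\<integral>\<^sup>+\<omega>. (\<Sum>l. indicator (?E l) \<omega>) \<partial>?P)"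
  proof (rule nn_integral_cong_AE, use AE in eventually_elim)
    fix \<omega> :: "nat \<Rightarrow> nat" assume \<omega>: "finite (L \<omega>) \<and> (\<forall>l. \<omega> l = x \<longrightarrow>
      (l \<in> L \<omega> \<longleftrightarrow> (\<forall>i\<le>l. \<omega> i \<notin> B) \<and> (\<lambda>i. \<omega> (i + l)) \<in> S))"
    have "(\<Sum>l. indicator (?E l) \<omega> :: ennreal) = (\<Sum>l\<in>L \<omega>. indicator (?E l) \<omega>)"
      using \<omega> by (intro suminf_finite) (auto simp: indicator_def)
    also have "\<dots> = (\<Sum>l\<in>L \<omega>. ennreal (indicator {x} (\<omega> l)))"
      using \<omega> by (intro sum.cong) (auto simp: indicator_def)
    also have "\<dots> = ennreal (?f \<omega>)"
      by (intro sum_ennreal) simp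
    finally show "ennreal (?f \<omega>) = (\<Sum>l. indicator (?E l) \<omega>)" by simp
  qed
  also have "\<dots> = (\<Sum>l. emeasure ?P (?E l))"
    using E by (subst nn_integral_suminf) simp_all
  also have "\<dots> = (\<Sum>l. emeasure ?P {\<omega>. \<omega> l = x \<and> (\<forall>i\<le>l. \<omega> i \<notin> B)} * emeasure (law x) S)"
  proof (rule suminf_cong)
    fix l
    \<comment> \<open>Avoiding \<open>B\<close> up to time \<open>l\<close> is a property of the
      prefix list, as \<open>markov\<close> requires.\<close>
    have "set (map \<omega> [0..<Suc l]) \<inter> B = {} \<longleftrightarrow> (\<forall>i\<le>l. \<omega> i \<notin> B)" for \<omega> :: "nat \<Rightarrow> nat"
      by (auto simp: disjoint_iff less_Suc_eq_le simp del: upt_Suc)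
    then show "emeasure ?P (?E l) =
        emeasure ?P {\<omega>. \<omega> l = x \<and> (\<forall>i\<le>l. \<omega> i \<notin> B)} * emeasure (law x) S"
      using markov [OF S, of p \<nu> l x "\<lambda>xs. set xs \<inter> B = {}"] by (simp only:)
  qed
  also have "\<dots> = (\<Sum>l. emeasure ?P {\<omega>. \<omega> l = x \<and> (\<forall>i\<le>l. \<omega> i \<notin> B)}) * emeasure (law x) S"
    by (rule ennreal_suminf_multc)
  finally show ?thesis
    by (simp only: enn2real_mult measure_def)
qed

text \<open>The case of \<open>integral_visits\<close> with no condition on the future, that is,
  with \<open>S\<close> the whole space.\<close>

lemma visits_eq:
  assumes \<nu>: "set_pmf \<nu> \<subseteq> V" and x: "x \<notin> B"
  shows "visits p \<nu> B x =
    enn2real (\<Sum>l. emeasure (path_law p \<nu>) {\<omega>. \<omega> l = x \<and> (\<forall>i\<le>l. \<omega> i \<notin> B)})"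
proof -
  have "visits p \<nu> B x = (\<integral>\<omega>. (\<Sum>l\<in>{l. \<forall>i<l. \<omega> i \<notin> B}. indicator {x} (\<omega> l)) \<partial>path_law p \<nu>)"
    by (simp only: visits_def le_hit_time_iff)
  also have "\<dots> = enn2real (\<Sum>l. emeasure (path_law p \<nu>) {\<omega>. \<omega> l = x \<and> (\<forall>i\<le>l. \<omega> i \<notin> B)})
      * measure (law x) (space path_space)"
  proof (rule integral_visits)
    show "AE \<omega> in path_law p \<nu>. finite {l. \<forall>i<l. \<omega> i \<notin> B} \<and> (\<forall>l. \<omega> l = x \<longrightarrow>
        (l \<in> {l. \<forall>i<l. \<omega> i \<notin> B} \<longleftrightarrow>
         (\<forall>i\<le>l. \<omega> i \<notin> B) \<and> (\<lambda>i. \<omega> (i + l)) \<in> space path_space))"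
      using AE_hits_B [OF \<nu>]
    proof eventually_elim
      fix \<omega> :: "nat \<Rightarrow> nat" assume "\<exists>i. \<omega> i \<in> B"
      then obtain k where "\<omega> k \<in> B" by blast
      then have "{l. \<forall>i<l. \<omega> i \<notin> B} \<subseteq> {..k}"
        by (auto simp: not_less [symmetric])
      then have "finite {l. \<forall>i<l. \<omega> i \<notin> B}"
        by (rule finite_subset) simp
      \<comment> \<open>At a visit to \<open>x\<close> at time \<open>l\<close> the state is outside
        \<open>B\<close>, so the bounds \<open>i < l\<close> and \<open>i \<le> l\<close>
        agree.\<close>
      then show "finite {l. \<forall>i<l. \<omega> i \<notin> B} \<and> (\<forall>l. \<omega> l = x \<longrightarrow>
        (l \<in> {l. \<forall>i<l. \<omega> i \<notin> B} \<longleftrightarrow>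
         (\<forall>i\<le>l. \<omega> i \<notin> B) \<and> (\<lambda>i. \<omega> (i + l)) \<in> space path_space))"
        using x by (auto simp: space_path_space le_less)
    qed
    show "Measurable.pred path_space (\<lambda>\<omega>. l \<in> {l. \<forall>i<l. \<omega> i \<notin> B})" for l
      unfolding mem_Collect_eq by measurable
  qed simp
  also have "measure (law x) (space path_space) = 1"
    using path.prob_space [of p "return_pmf x"] by (simp add: space_path_space)
  finally show ?thesis by simp
qed

section \<open>The last exit from \<open>A\<close> and the split visit counts\<close>

lemma last_exit_eq: "last_exit A B \<omega> = Max {l. \<omega> l \<in> A \<and> (\<forall>i\<le>l. \<omega> i \<notin> B)}"
  by (simp only: last_exit_def less_hit_time_iff)

lemma measurable_last_exit [measurable]: "last_exit A B \<in> path_space \<rightarrow>\<^sub>M count_space UNIV"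
  unfolding last_exit_eq [abs_def] by measurable

text \<open>Gives \<open>Max\<close> in \<open>last_exit\<close> its meaning: time 0 belongs to the
  set, and a visit to \<open>B\<close> at \<open>k\<close> bounds it.\<close>

lemma exits_finite_nonempty:
  fixes \<omega> :: "nat \<Rightarrow> nat"
  assumes "\<omega> 0 \<in> A" "\<omega> k \<in> B"
  shows "finite {l. \<omega> l \<in> A \<and> (\<forall>i\<le>l. \<omega> i \<notin> B)}" "{l. \<omega> l \<in> A \<and> (\<forall>i\<le>l. \<omega> i \<notin> B)} \<noteq> {}"
proof -
  have "{l. \<omega> l \<in> A \<and> (\<forall>i\<le>l. \<omega> i \<notin> B)} \<subseteq> {..k}"
    using assms(2) nat_le_linear by blast
  then show "finite {l. \<omega> l \<in> A \<and> (\<forall>i\<le>l. \<omega> i \<notin> B)}"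
    by (rule finite_subset) simp
  have "0 \<in> {l. \<omega> l \<in> A \<and> (\<forall>i\<le>l. \<omega> i \<notin> B)}"
    using assms disjoint by auto
  then show "{l. \<omega> l \<in> A \<and> (\<forall>i\<le>l. \<omega> i \<notin> B)} \<noteq> {}" by blast
qed

lemma all_le_add_iff:
  "(\<forall>i\<le>l + m. P i) \<longleftrightarrow> (\<forall>i\<le>l. P i) \<and> (\<forall>i\<le>m. P (i + l))" for l m :: nat
proof (intro iffI conjI allI impI)
  fix i assume "i \<le> l + m" and *: "(\<forall>i\<le>l. P i) \<and> (\<forall>i\<le>m. P (i + l))"
  then show "P i"
    by (cases "i \<le> l") (auto simp: not_le dest: spec [of _ "i - l"])
qed auto

text \<open>The maximum is at least \<open>l\<close> iff some member has the form
  \<open>l + m\<close>; avoiding \<open>B\<close> up to \<open>l + m\<close> then splits into a past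
  and a future part.\<close>

lemma le_last_exit_iff:
  assumes "\<omega> 0 \<in> A" "\<omega> k \<in> B"
  shows "l \<le> last_exit A B \<omega> \<longleftrightarrow> (\<forall>i\<le>l. \<omega> i \<notin> B) \<and> (\<lambda>i. \<omega> (i + l)) \<in> hits_first A B"
proof -
  have "l \<le> last_exit A B \<omega> \<longleftrightarrow> (\<exists>m\<ge>l. \<omega> m \<in> A \<and> (\<forall>i\<le>m. \<omega> i \<notin> B))"
    unfolding last_exit_eq using exits_finite_nonempty [OF assms] by (subst Max_ge_iff) auto
  also have "\<dots> \<longleftrightarrow> (\<exists>m. \<omega> (l + m) \<in> A \<and> (\<forall>i\<le>l + m. \<omega> i \<notin> B))"
    by (metis le_add1 le_Suc_ex)
  finally show ?thesis
    unfolding all_le_add_iff hits_first_def by (auto simp: add.commute)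
qed

lemma last_exit_le_iff:
  assumes "\<omega> 0 \<in> A" "\<omega> k \<in> B" and l: "\<forall>i\<le>l. \<omega> i \<notin> B"
  shows "last_exit A B \<omega> \<le> l \<longleftrightarrow> (\<lambda>i. \<omega> (i + l)) \<in> never_returns A B"
proof -
  have "last_exit A B \<omega> \<le> l \<longleftrightarrow> (\<forall>m. \<omega> m \<in> A \<and> (\<forall>i\<le>m. \<omega> i \<notin> B) \<longrightarrow> m \<le> l)"
    unfolding last_exit_eq using exits_finite_nonempty [OF assms(1,2)] by (subst Max_le_iff) auto
  \<comment> \<open>Times below \<open>l\<close> satisfy the bound anyway; the others are
    \<open>l + m\<close>, and \<open>l + m \<le> l\<close> means \<open>m = 0\<close>.\<close>
  also have "\<dots> \<longleftrightarrow> (\<forall>m. \<omega> (l + m) \<in> A \<and> (\<forall>i\<le>l + m. \<omega> i \<notin> B) \<longrightarrow> m = 0)"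
    by (metis add_0_right add_le_same_cancel1 le_add_same_cancel1 le_zero_eq le_Suc_ex nle_le)
  finally show ?thesis
    unfolding all_le_add_iff never_returns_def using l by (simp add: add.commute)
qed

lemma visits_nonrea_eq:
  assumes \<nu>: "set_pmf \<nu> \<subseteq> A" and x: "x \<in> V - B"
  shows "visits_nonrea p \<nu> A B x = visits p \<nu> B x * (1 - q x)"
proof -
  have \<nu>V: "set_pmf \<nu> \<subseteq> V" using \<nu> A_subset by blast
  have "visits_nonrea p \<nu> A B x =
      enn2real (\<Sum>l. emeasure (path_law p \<nu>) {\<omega>. \<omega> l = x \<and> (\<forall>i\<le>l. \<omega> i \<notin> B)})
      * measure (law x) (hits_first A B)"
    unfolding visits_nonrea_def
  proof (rule integral_visits [OF hits_first_in_sets])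
    show "Measurable.pred path_space (\<lambda>\<omega>. l \<in> {..last_exit A B \<omega>})" for l
      unfolding atMost_iff by measurable
    show "AE \<omega> in path_law p \<nu>. finite {..last_exit A B \<omega>} \<and> (\<forall>l. \<omega> l = x \<longrightarrow>
        (l \<in> {..last_exit A B \<omega>} \<longleftrightarrow>
         (\<forall>i\<le>l. \<omega> i \<notin> B) \<and> (\<lambda>i. \<omega> (i + l)) \<in> hits_first A B))"
      using AE_start [of \<nu> p] AE_hits_B [OF \<nu>V]
    proof eventually_elim
      fix \<omega> :: "nat \<Rightarrow> nat" assume "\<omega> 0 \<in> set_pmf \<nu>" "\<exists>i. \<omega> i \<in> B"
      then obtain k where "\<omega> 0 \<in> A" "\<omega> k \<in> B" using \<nu> by blast
      then show "finite {..last_exit A B \<omega>} \<and> (\<forall>l. \<omega> l = x \<longrightarrow>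
          (l \<in> {..last_exit A B \<omega>} \<longleftrightarrow>
           (\<forall>i\<le>l. \<omega> i \<notin> B) \<and> (\<lambda>i. \<omega> (i + l)) \<in> hits_first A B))"
        by (simp only: atMost_iff le_last_exit_iff) simp
    qed
  qed
  then show ?thesis
    using x by (simp add: visits_eq [OF \<nu>V] measure_hits_first_A)
qed

text \<open>The visit at the last exit itself counts both here and in \<open>visits_nonrea\<close>.
  On \<open>A\<close> the factor is therefore the one-step sum, whereas \<open>q x\<close> is 0
  there; outside \<open>A\<close> and \<open>B\<close> the two coincide by
  \<open>committor_step\<close>.\<close>

lemma visits_rea_eq:
  assumes \<nu>: "set_pmf \<nu> \<subseteq> A" and x: "x \<in> V - B"
  shows "visits_rea p \<nu> A B x = visits p \<nu> B x * (\<Sum>z\<in>V. pmf (p x) z * q z)"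
proof -
  have \<nu>V: "set_pmf \<nu> \<subseteq> V" using \<nu> A_subset by blast
  let ?L = "\<lambda>\<omega>. {l. last_exit A B \<omega> \<le> l \<and> (\<forall>i<l. \<omega> i \<notin> B)}"
  have "visits_rea p \<nu> A B x =
      enn2real (\<Sum>l. emeasure (path_law p \<nu>) {\<omega>. \<omega> l = x \<and> (\<forall>i\<le>l. \<omega> i \<notin> B)})
      * measure (law x) (never_returns A B)"
    unfolding visits_rea_def le_hit_time_iff
  proof (rule integral_visits [OF never_returns_in_sets])
    show "Measurable.pred path_space (\<lambda>\<omega>. l \<in> ?L \<omega>)" for l
      unfolding mem_Collect_eq by measurable
    show "AE \<omega> in path_law p \<nu>. finite (?L \<omega>) \<and> (\<forall>l. \<omega> l = x \<longrightarrow>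
        (l \<in> ?L \<omega> \<longleftrightarrow> (\<forall>i\<le>l. \<omega> i \<notin> B) \<and> (\<lambda>i. \<omega> (i + l)) \<in> never_returns A B))"
      using AE_start [of \<nu> p] AE_hits_B [OF \<nu>V]
    proof eventually_elim
      fix \<omega> :: "nat \<Rightarrow> nat" assume "\<omega> 0 \<in> set_pmf \<nu>" "\<exists>i. \<omega> i \<in> B"
      then obtain k where k: "\<omega> 0 \<in> A" "\<omega> k \<in> B" using \<nu> by blast
      then have "?L \<omega> \<subseteq> {..k}"
        by (auto simp: not_less [symmetric])
      then have "finite (?L \<omega>)"
        by (rule finite_subset) simp
      moreover have "l \<in> ?L \<omega> \<longleftrightarrow>
          (\<forall>i\<le>l. \<omega> i \<notin> B) \<and> (\<lambda>i. \<omega> (i + l)) \<in> never_returns A B" if "\<omega> l = x" for l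
      proof -
        \<comment> \<open>Again \<open>\<omega> l = x\<close> lies outside \<open>B\<close>, so time
          \<open>l\<close> may be added to the range.\<close>
        have "(\<forall>i<l. \<omega> i \<notin> B) \<longleftrightarrow> (\<forall>i\<le>l. \<omega> i \<notin> B)"
          using x that by (auto simp: le_less)
        then show ?thesis
          using last_exit_le_iff [OF k, of l] by auto
      qed
      ultimately show "finite (?L \<omega>) \<and> (\<forall>l. \<omega> l = x \<longrightarrow>
          (l \<in> ?L \<omega> \<longleftrightarrow> (\<forall>i\<le>l. \<omega> i \<notin> B) \<and> (\<lambda>i. \<omega> (i + l)) \<in> never_returns A B))"
        by blast
    qed
  qed
  then show ?thesis
    using x by (simp add: visits_eq [OF \<nu>V] measure_never_returns)
qed

section \<open>Cancelling the normalisations of the two transition probabilities\<close>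

lemma committor_nonneg: "0 \<le> q x" and committor_le_1: "q x \<le> 1"
  by (simp_all add: committor_eq)

lemma V_plus_iff: "x \<in> V_plus V p A B \<longleftrightarrow> x \<in> V - B \<and> (\<Sum>z\<in>V. pmf (p x) z * q z) \<noteq> 0"
  using sum_nonneg [of V "\<lambda>z. pmf (p x) z * q z"] by (auto simp: V_plus_def committor_nonneg less_le)

text \<open>On \<open>A\<close> the committor vanishes; elsewhere it equals the one-step sum, which
  is 0 outside \<open>V_plus\<close>. So targets where \<open>p_rea\<close> is not defined carry no
  reactive flux.\<close>

lemma committor_eq_0:
  assumes "y \<in> V" "y \<notin> V_plus V p A B \<union> B"
  shows "q y = 0"
  using assms committor_A [of y] committor_step [of y] by (cases "y \<in> A") (auto simp: V_plus_iff)

text \<open>The denominator cancels unless it is 0. A target with \<open>q y = 1\<close> gives 0 on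
  both sides, which matches the extension of \<open>p_nonrea\<close> by 0.\<close>

lemma p_nonrea_eq:
  assumes "x \<in> V" "y \<in> V"
  shows "(1 - q x) * p_nonrea V p A B x y = (if q x = 1 then 0 else pmf (p x) y * (1 - q y))"
proof -
  have "v \<in> V_minus V p A B \<longleftrightarrow> q v \<noteq> 1" if "v \<in> V" for v
    using that committor_le_1 [of v] by (auto simp: V_minus_def)
  then show ?thesis
    using assms by (auto simp: p_nonrea_def)
qed

text \<open>Both denominators in \<open>p_rea\<close> equal the one-step sum, off \<open>A\<close>
  by \<open>committor_step\<close>. Outside \<open>V_plus\<close> this sum of nonnegative terms is
  0, so each \<open>pmf (p x) z * q z\<close> is 0.\<close>

lemma p_rea_eq:
  assumes "x \<in> V - B" "y \<in> V"
  shows "(\<Sum>z\<in>V. pmf (p x) z * q z) * p_rea V p A B x y = pmf (p x) y * q y"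
proof (cases "x \<in> V_plus V p A B")
  case True
  then have "q x = (\<Sum>z\<in>V. pmf (p x) z * q z)" if "x \<notin> A"
    using that assms by (intro committor_step) simp
  then show ?thesis
    using True committor_eq_0 [of y] assms by (auto simp: p_rea_def V_plus_iff)
next
  case False
  then have "(\<Sum>z\<in>V. pmf (p x) z * q z) = 0"
    using assms by (simp add: V_plus_iff)
  then show ?thesis
    using assms sum_nonneg_eq_0_iff [OF finite_V, of "\<lambda>z. pmf (p x) z * q z"]
    by (auto simp: committor_nonneg)
qed

text \<open>The committor attains its upper bound 1 at \<open>x\<close>, and \<open>x\<close> is not
  in \<open>A\<close>, so by harmonicity every possible jump leads to a state with committor 1. This
  settles the case left open by \<open>p_nonrea_eq\<close>.\<close>

lemma committor_eq_1_step:
  assumes "x \<in> V - B" "q x = 1" "y \<in> V"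
  shows "pmf (p x) y * (1 - q y) = 0"
proof -
  have "x \<notin> A" using assms committor_A by auto
  then have "(\<Sum>z\<in>V. pmf (p x) z * (1 - q z)) = 0"
    using committor_step [of x] assms by (simp add: right_diff_distrib sum_subtractf sum_pmf)
  then show ?thesis
    using assms sum_nonneg_eq_0_iff [OF finite_V, of "\<lambda>z. pmf (p x) z * (1 - q z)"]
    by (auto simp: committor_le_1)
qed

lemma flux_decomposition:
  assumes \<nu>: "set_pmf \<nu> \<subseteq> A" and x: "x \<in> V - B" and y: "y \<in> V"
  shows "visits p \<nu> B x * pmf (p x) y =
    visits_nonrea p \<nu> A B x * p_nonrea V p A B x y + visits_rea p \<nu> A B x * p_rea V p A B x y"
proof -
  have "visits_nonrea p \<nu> A B x * p_nonrea V p A B x y + visits_rea p \<nu> A B x * p_rea V p A B x y =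
      visits p \<nu> B x * ((1 - q x) * p_nonrea V p A B x y +
        (\<Sum>z\<in>V. pmf (p x) z * q z) * p_rea V p A B x y)"
    by (simp only: visits_nonrea_eq [OF \<nu> x] visits_rea_eq [OF \<nu> x] mult.assoc distrib_left)
  \<comment> \<open>For \<open>q x = 1\<close> the left side has the factor 0 and the right side is
    0 by \<open>committor_eq_1_step\<close>.\<close>
  also have "(1 - q x) * p_nonrea V p A B x y = pmf (p x) y * (1 - q y)"
    using p_nonrea_eq [of x y] committor_eq_1_step [of x y] x y by auto
  also have "(\<Sum>z\<in>V. pmf (p x) z * q z) * p_rea V p A B x y = pmf (p x) y * q y"
    by (rule p_rea_eq [OF x y])
  finally show ?thesis
    by (simp add: algebra_simps)
qed

end

section \<open>From the reachability assumptions to the decomposition of fluxes\<close>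

lemma reachable_imp_rtrancl:
  assumes "reachable V p A B S x"
  shows "\<exists>s\<in>S. (x, s) \<in> {(x, y). pmf (p x) y > 0}\<^sup>*"
proof -
  from assms obtain k w where w: "w 0 = x" "w k \<in> S" "\<forall>l<k. pmf (p (w l)) (w (Suc l)) > 0"
    unfolding reachable_def by blast
  have "(w 0, w l) \<in> {(x, y). pmf (p x) y > 0}\<^sup>*" if "l \<le> k" for l
    using that
  proof (induction l)
    case (Suc l)
    then have "(w l, w (Suc l)) \<in> {(x, y). pmf (p x) y > 0}" using w(3) by simp
    with Suc show ?case by (meson Suc_leD rtrancl.rtrancl_into_rtrancl)
  qed simp
  from this [of k] w show ?thesis by blast
qed

theorem proposition8:
  fixes n :: nat and V A B :: "nat set" and p :: "nat \<Rightarrow> nat pmf" and \<mu> :: "nat pmf"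
  assumes "n > 1" and V: "V = {1..n}"
    and p: "\<And>x. x \<in> V \<Longrightarrow> set_pmf (p x) \<subseteq> V"
    and "A \<subseteq> V" "B \<subseteq> V" "A \<noteq> {}" "B \<noteq> {}" "A \<inter> B = {}"
    and \<mu>: "set_pmf \<mu> \<subseteq> A"
    and "V - (A \<union> B) \<noteq> {}"
    and "\<And>x. x \<in> V - (A \<union> B) \<Longrightarrow> reachable V p A B A x \<or> reachable V p A B B x"
    and "\<And>x. x \<in> A \<Longrightarrow> reachable V p A B B x"
  shows "\<forall>x \<in> V - B. \<forall>y \<in> V.
      visits p \<mu> B x * pmf (p x) y =
        visits_nonrea p \<mu> A B x * p_nonrea V p A B x y + visits_rea p \<mu> A B x * p_rea V p A B x y
    \<and> flux p \<mu> B x y = flux_nonrea V p \<mu> A B x y + flux_rea V p \<mu> A B x y"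
proof -
  let ?R = "{(x, y). pmf (p x) y > 0}\<^sup>*"
  have from_A: "\<exists>b\<in>B. (x, b) \<in> ?R" if "x \<in> A" for x
    using assms(12) [OF that] by (rule reachable_imp_rtrancl)
  have "\<exists>b\<in>B. (x, b) \<in> ?R" if x: "x \<in> V" for x
  proof -
    consider "x \<in> A" | "x \<in> B" | "reachable V p A B A x" | "reachable V p A B B x"
      using assms(11) [of x] x by blast
    then show ?thesis
    proof cases
      case 3
      \<comment> \<open>A path into \<open>A\<close> is continued by one from its end point to
        \<open>B\<close>.\<close>
      then obtain a where "a \<in> A" "(x, a) \<in> ?R" using reachable_imp_rtrancl by blast
      with from_A [of a] show ?thesis by (meson rtrancl_trans)
    next
      case 4
      then show ?thesis by (rule reachable_imp_rtrancl)
    qed (use from_A in auto)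
  qed
  then interpret finite_chain V A B p
    using assms by unfold_locales simp_all
  \<comment> \<open>The case distinctions in the fluxes agree with the extension of the transition
    probabilities by 0, so both displayed identities say the same.\<close>
  have "flux_nonrea V p \<mu> A B x y = visits_nonrea p \<mu> A B x * p_nonrea V p A B x y"
    "flux_rea V p \<mu> A B x y = visits_rea p \<mu> A B x * p_rea V p A B x y" for x y
    by (auto simp: flux_nonrea_def flux_rea_def p_nonrea_def p_rea_def)
  then show ?thesis
    using flux_decomposition [OF \<mu>] by (simp add: flux_def)
qed

end
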